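(* For every $N\ge 1$, all finite nonempty input sets $\mathcal{A}_1,\dots,\mathcal{A}_N$ (with $\bm{\mathcal{A}}=\mathcal{A}_1\times\cdots\times\mathcal{A}_N$) and every finite nonempty output set $\mathcal{B}$, $$\mathcal{C}^{(\mathrm{sep})}_N(\bm{\mathcal{A}};\mathcal{B})=\mathfrak{I}_N(\bm{\mathcal{A}};\mathcal{B}).$$ That is, an $N$-sender MAC is separable if and only if its second-order interference vanishes for every pair of senders.
   Context: A multiple access channel (MAC) $\bm{\mathcal{A}}\to\mathcal{B}$ is a family of conditional probabilities $p(b|a_1\cdots a_N)\ge 0$, $b\in\mathcal{B}$, $a_i\in\mathcal{A}_i$, with $\sum_b p(b|a_1\cdots a_N)=1$ for every input. Separable MACs: $\mathcal{C}^{(\mathrm{sep})}_N(\bm{\mathcal{A}};\mathcal{B})$ is the set of MACs of the form $p(b|a_1\cdots a_N)=\sum_{i=1}^N p_i\,g_i(b|a_i)$, where $(p_i)_{i=1}^N$ is a probability distribution and each $g_i$ is a stochastic map $\mathcal{A}_i\to\mathcal{B}$ (conditional probability distribution). Second-order interference: for a MAC $\mathbf{p}$ and $i\neq j$, let $\mathcal{M}^{(i,j)}(\mathbf{p})$ be the set of two-sender MACs $p(b|a_i,a_j)$ obtained from $\mathbf{p}$ by fixing the inputs $a_k$ of all senders $k\ne i,j$ to arbitrary values. Put $$I_2^{(i,j)}(\mathbf{p})=\max\left|p(b|a_i,a_j)+p(b|a_i',a_j')-p(b|a_i,a_j')-p(b|a_i',a_j)\right|,$$ the maximum being over all two-sender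 MACs in $\mathcal{M}^{(i,j)}(\mathbf{p})$, all $b\in\mathcal{B}$, $a_i,a_i'\in\mathcal{A}_i$, $a_j,a_j'\in\mathcal{A}_j$. $\mathfrak{I}_N(\bm{\mathcal{A}};\mathcal{B})$ is the set of all MACs $\mathbf{p}:\bm{\mathcal{A}}\to\mathcal{B}$ with $I_2^{(i,j)}(\mathbf{p})=0$ for all pairs $i\ne j$. *)

theory Defs
  imports Complex_Main "HOL-Library.FuncSet"
begin

text \<open>
  Conditional probabilities \<open>p(b|x)\<close> are written \<open>p x b\<close>. They are extensional in both arguments,
  so that two stochastic maps are equal iff they agree for all inputs in \<open>X\<close> and outputs in \<open>B\<close>.
\<close>

definition stochastic_maps :: "'x set \<Rightarrow> 'b set \<Rightarrow> ('x \<Rightarrow> 'b \<Rightarrow> real) set" where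
  "stochastic_maps X B = {p \<in> X \<rightarrow>\<^sub>E (B \<rightarrow>\<^sub>E {0..}). \<forall>x\<in>X. (\<Sum>b\<in>B. p x b) = 1}"

text \<open>
  Senders are numbered from 1 to \<open>N\<close>, with input set \<open>A i\<close> for sender \<open>i\<close>; the input sets may
  differ, but are subsets of a common type.
\<close>

definition inputs :: "nat \<Rightarrow> (nat \<Rightarrow> 'a set) \<Rightarrow> (nat \<Rightarrow> 'a) set" where
  "inputs N A = (\<Pi>\<^sub>E i\<in>{1..N}. A i)"

definition MACs :: "nat \<Rightarrow> (nat \<Rightarrow> 'a set) \<Rightarrow> 'b set \<Rightarrow> ((nat \<Rightarrow> 'a) \<Rightarrow> 'b \<Rightarrow> real) set" where
  "MACs N A B = stochastic_maps (inputs N A) B"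

definition separable_MACs ::
    "nat \<Rightarrow> (nat \<Rightarrow> 'a set) \<Rightarrow> 'b set \<Rightarrow> ((nat \<Rightarrow> 'a) \<Rightarrow> 'b \<Rightarrow> real) set" where
  "separable_MACs N A B =
     {p \<in> MACs N A B. \<exists>w :: nat \<Rightarrow> real. \<exists>g :: nat \<Rightarrow> 'a \<Rightarrow> 'b \<Rightarrow> real.
        (\<forall>i\<in>{1..N}. 0 \<le> w i) \<and> (\<Sum>i=1..N. w i) = 1 \<and>
        (\<forall>i\<in>{1..N}. g i \<in> stochastic_maps (A i) B) \<and>
        (\<forall>a\<in>inputs N A. \<forall>b\<in>B. p a b = (\<Sum>i=1..N. w i * g i (a i) b))}"

text \<open>
  The tuple \<open>c\<close> fixes the inputs of all senders other than \<open>i\<close> and \<open>j\<close>; its components at \<open>i\<close> and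
  \<open>j\<close> are overwritten. The definition is meant for \<open>i \<noteq> j\<close>.
\<close>

definition two_sender_MACs ::
    "nat \<Rightarrow> (nat \<Rightarrow> 'a set) \<Rightarrow> nat \<Rightarrow> nat \<Rightarrow> ((nat \<Rightarrow> 'a) \<Rightarrow> 'b \<Rightarrow> real)
      \<Rightarrow> ('a \<times> 'a \<Rightarrow> 'b \<Rightarrow> real) set" where
  "two_sender_MACs N A i j p =
     {(\<lambda>(x, y)\<in>A i \<times> A j. p (c(i := x, j := y))) | c. c \<in> inputs N A}"

definition interference2 ::
    "nat \<Rightarrow> (nat \<Rightarrow> 'a set) \<Rightarrow> 'b set \<Rightarrow> nat \<Rightarrow> nat \<Rightarrow> ((nat \<Rightarrow> 'a) \<Rightarrow> 'b \<Rightarrow> real) \<Rightarrow> real" where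
  "interference2 N A B i j p =
     Max {\<bar>q (x, y) b + q (x', y') b - q (x, y') b - q (x', y) b\<bar> | q b x x' y y'.
            q \<in> two_sender_MACs N A i j p \<and> b \<in> B \<and>
            x \<in> A i \<and> x' \<in> A i \<and> y \<in> A j \<and> y' \<in> A j}"

definition interference_free_MACs ::
    "nat \<Rightarrow> (nat \<Rightarrow> 'a set) \<Rightarrow> 'b set \<Rightarrow> ((nat \<Rightarrow> 'a) \<Rightarrow> 'b \<Rightarrow> real) set" where
  "interference_free_MACs N A B =
     {p \<in> MACs N A B. \<forall>i\<in>{1..N}. \<forall>j\<in>{1..N}. i \<noteq> j \<longrightarrow> interference2 N A B i j p = 0}"

end

theory Submission
  imports Defs
begin

text \<open>
  Vanishing of all mixed second differences makes \<open>p a b\<close> additive in the inputs: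
  \<open>p a b = p c b + (\<Sum>i. h i (a i) b)\<close> with \<open>h i x b = p (c(i := x)) b - p c b\<close>, for any base
  point \<open>c\<close>. Subtracting from each \<open>h i\<close> its minimum \<open>m i b\<close> over the input makes the summands
  nonnegative, and the remaining constant \<open>p c b + (\<Sum>i. m i b)\<close> is nonnegative because it is the
  value of \<open>p\<close> at a tuple of minimizers; it is given to sender 1. As \<open>\<Sum>b. h i x b = 0\<close>, the total
  mass of each summand does not depend on the input, so normalizing the summands gives the
  weights and the stochastic maps.
\<close>

section \<open>Mixed second differences and additivity in the inputs\<close>

lemma sum_second_difference_eq_0:
  fixes f :: "'i \<Rightarrow> 'a \<Rightarrow> real"
  assumes "i \<noteq> j"
  shows "(\<Sum>k\<in>I. f k ((c(i := x, j := y)) k)) + (\<Sum>k\<in>I. f k ((c(i := x', j := y')) k))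
       - (\<Sum>k\<in>I. f k ((c(i := x, j := y')) k)) - (\<Sum>k\<in>I. f k ((c(i := x', j := y)) k)) = 0"
  \<comment> \<open>In the merged sum every term vanishes: since \<open>i\<close> and
    \<open>j\<close> differ, coordinate \<open>k\<close> sees at most one of the two updates, so its
    four values cancel in pairs.\<close>
  unfolding sum.distrib[symmetric] sum_subtractf[symmetric]
  using assms by (intro sum.neutral) auto

text \<open>Coordinates are switched from \<open>c\<close> to \<open>a\<close> one at a time. By
  \<open>diff\<close>, switching one coordinate leaves the increments along the others unchanged, so
  all increments can be measured at the original base point.\<close>

lemma additive_if_second_differences_eq_0:
  fixes F :: "('i \<Rightarrow> 'a) \<Rightarrow> real"
  assumes diff: "\<And>c i j x y. \<lbrakk>c \<in> Pi\<^sub>E I A; i \<in> I; j \<in> I; i \<noteq> j; x \<in> A i; y \<in> A j\<rbrakk> \<Longrightarrow>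
      F (c(i := x, j := y)) - F (c(i := x)) = F (c(j := y)) - F c"
    and a: "a \<in> Pi\<^sub>E I A" and "finite S" "S \<subseteq> I" "c \<in> Pi\<^sub>E I A"
  shows "F (override_on c a S) = F c + (\<Sum>i\<in>S. F (c(i := a i)) - F c)"
  using assms(3-)
proof (induction S arbitrary: c rule: finite_induct)
  case empty
  show ?case by simp
next
  case (insert j S)
  have S: "S \<subseteq> I" and j: "j \<in> I"
    using insert.prems(1) by simp_all
  \<comment> \<open>The new coordinate is absorbed into the base point, hence the induction over
    arbitrary \<open>c\<close>; \<open>F d - F c\<close> is the summand for
    \<open>j\<close>.\<close>
  define d where "d = c(j := a j)"
  have d: "d \<in> Pi\<^sub>E I A"
    using PiE_fun_upd[of "a j" A j c I, OF PiE_mem[OF a j] insert.prems(2)]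
    unfolding d_def insert_absorb[OF j] .
  have eq: "override_on c a (insert j S) = override_on d a S"
    by (simp add: override_on_def d_def fun_eq_iff)
  have "F (override_on d a S) = F d + (\<Sum>i\<in>S. F (d(i := a i)) - F d)"
    by (rule insert.IH[OF S d])
  moreover have "(\<Sum>i\<in>S. F (d(i := a i)) - F d) = (\<Sum>i\<in>S. F (c(i := a i)) - F c)"
  proof (rule sum.cong[OF refl])
    fix i assume i: "i \<in> S"
    then have "i \<in> I" "j \<noteq> i"
      using S insert.hyps(2) by blast+
    then show "F (d(i := a i)) - F d = F (c(i := a i)) - F c"
      unfolding d_def using diff[OF insert.prems(2) j] PiE_mem[OF a] j by blast
  qed
  ultimately show ?case
    unfolding eq sum.insert[OF insert.hyps] d_def by linarith
qed

text \<open>The case \<open>S = I\<close>: both tuples are extensional, so overriding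
  \<open>c\<close> on all of \<open>I\<close> yields \<open>a\<close> itself.\<close>

lemma additive_if_second_differences_eq_0':
  fixes F :: "('i \<Rightarrow> 'a) \<Rightarrow> real"
  assumes "\<And>c i j x y. \<lbrakk>c \<in> Pi\<^sub>E I A; i \<in> I; j \<in> I; i \<noteq> j; x \<in> A i; y \<in> A j\<rbrakk> \<Longrightarrow>
      F (c(i := x, j := y)) - F (c(i := x)) = F (c(j := y)) - F c"
    and "finite I" "a \<in> Pi\<^sub>E I A" "c \<in> Pi\<^sub>E I A"
  shows "F a = F c + (\<Sum>i\<in>I. F (c(i := a i)) - F c)"
proof -
  have "override_on c a I = a"
    using assms(3,4) by (auto simp: override_on_def PiE_iff extensional_def fun_eq_iff)
  then show ?thesis
    using additive_if_second_differences_eq_0[of I A F a I c] assms by simp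
qed

section \<open>Vanishing interference as a system of linear equations\<close>

lemma interference2_eq_0_iff:
  assumes "\<forall>i\<in>{1..N}. finite (A i) \<and> A i \<noteq> {}" "finite B" "B \<noteq> {}"
    and ij: "i \<in> {1..N}" "j \<in> {1..N}"
  shows "interference2 N A B i j p = 0 \<longleftrightarrow>
    (\<forall>c\<in>inputs N A. \<forall>b\<in>B. \<forall>x\<in>A i. \<forall>x'\<in>A i. \<forall>y\<in>A j. \<forall>y'\<in>A j.
       p (c(i := x, j := y)) b + p (c(i := x', j := y')) b
       - p (c(i := x, j := y')) b - p (c(i := x', j := y)) b = 0)" (is "_ \<longleftrightarrow> ?R")
proof -
  \<comment> \<open>The set under \<open>Max\<close> is parametrised as the image of the finite
    nonempty set \<open>T\<close> under the nonnegative function \<open>D\<close>; its maximum is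
    then 0 exactly when \<open>D\<close> vanishes on \<open>T\<close>.\<close>
  define D where "D = (\<lambda>(c, b, x, x', y, y').
       \<bar>p (c(i := x, j := y)) b + p (c(i := x', j := y')) b
       - p (c(i := x, j := y')) b - p (c(i := x', j := y)) b\<bar>)"
  define T where "T = inputs N A \<times> B \<times> A i \<times> A i \<times> A j \<times> A j"
  have "{\<bar>q (x, y) b + q (x', y') b - q (x, y') b - q (x', y) b\<bar> | q b x x' y y'.
            q \<in> two_sender_MACs N A i j p \<and> b \<in> B \<and>
            x \<in> A i \<and> x' \<in> A i \<and> y \<in> A j \<and> y' \<in> A j} = D ` T" (is "?L = _")
  proof (intro equalityI subsetI)
    fix z assume "z \<in> ?L"
    then obtain c b x x' y y' where "c \<in> inputs N A" "b \<in> B"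
      "x \<in> A i" "x' \<in> A i" "y \<in> A j" "y' \<in> A j" "z = D (c, b, x, x', y, y')"
      by (auto simp: two_sender_MACs_def D_def)
    then show "z \<in> D ` T"
      by (auto simp: T_def)
  next
    fix z assume "z \<in> D ` T"
    then obtain c b x x' y y' where *: "c \<in> inputs N A" "b \<in> B"
      "x \<in> A i" "x' \<in> A i" "y \<in> A j" "y' \<in> A j" "z = D (c, b, x, x', y, y')"
      by (auto simp: T_def)
    let ?q = "\<lambda>(x, y)\<in>A i \<times> A j. p (c(i := x, j := y))"
    have "?q \<in> two_sender_MACs N A i j p"
      using * by (auto simp: two_sender_MACs_def)
    moreover have "z = \<bar>?q (x, y) b + ?q (x', y') b - ?q (x, y') b - ?q (x', y) b\<bar>"
      using * by (simp add: D_def)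
    ultimately show "z \<in> ?L"
      using * by blast
  qed
  then have eq: "interference2 N A B i j p = Max (D ` T)"
    by (simp add: interference2_def)
  have fin: "finite T"
    unfolding T_def inputs_def using assms by (auto intro!: finite_cartesian_product finite_PiE)
  have ne: "T \<noteq> {}"
    using assms by (auto simp: T_def inputs_def PiE_eq_empty_iff)
  have nonneg: "0 \<le> D t" for t
    by (auto simp: D_def split: prod.splits)
  have "Max (D ` T) = 0 \<longleftrightarrow> (\<forall>t\<in>T. D t = 0)"
  proof
    assume "Max (D ` T) = 0"
    then have "D t \<le> 0" if "t \<in> T" for t
      using that fin Max_ge[of "D ` T" "D t"] by simp
    with nonneg show "\<forall>t\<in>T. D t = 0"
      by (auto intro: antisym)
  next
    assume "\<forall>t\<in>T. D t = 0"
    then have "D ` T = {0}"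
      using ne by force
    then show "Max (D ` T) = 0" by simp
  qed
  also have "\<dots> \<longleftrightarrow> ?R"
    by (simp add: T_def D_def)
  finally show ?thesis
    by (simp add: eq)
qed

section \<open>Stochastic maps and normalization\<close>

lemma stochastic_maps_nonneg:
  "p \<in> stochastic_maps X B \<Longrightarrow> x \<in> X \<Longrightarrow> b \<in> B \<Longrightarrow> 0 \<le> p x b"
  by (auto simp: stochastic_maps_def PiE_iff)

lemma stochastic_maps_sum:
  "p \<in> stochastic_maps X B \<Longrightarrow> x \<in> X \<Longrightarrow> (\<Sum>b\<in>B. p x b) = 1"
  by (auto simp: stochastic_maps_def)

lemma restrict_in_stochastic_maps:
  assumes "\<And>x b. x \<in> X \<Longrightarrow> b \<in> B \<Longrightarrow> 0 \<le> g x b" "\<And>x. x \<in> X \<Longrightarrow> (\<Sum>b\<in>B. g x b) = 1"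
  shows "(\<lambda>x\<in>X. \<lambda>b\<in>B. g x b) \<in> stochastic_maps X B"
  using assms by (auto simp: stochastic_maps_def)

lemma normalize_nonneg_kernel:
  assumes "finite B" "B \<noteq> {}"
    and nonneg: "\<And>x b. x \<in> X \<Longrightarrow> b \<in> B \<Longrightarrow> 0 \<le> v x b"
    and sum: "\<And>x. x \<in> X \<Longrightarrow> (\<Sum>b\<in>B. v x b) = w"
  obtains g where "g \<in> stochastic_maps X B" "\<And>x b. x \<in> X \<Longrightarrow> b \<in> B \<Longrightarrow> v x b = w * g x b"
proof (cases "w = 0")
  case True
  \<comment> \<open>With total mass 0 the kernel \<open>v\<close> vanishes, so any stochastic map
    will do; the uniform one is taken.\<close>
  have "(\<lambda>x\<in>X. \<lambda>b\<in>B. 1 / real (card B)) \<in> stochastic_maps X B"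
    using assms by (intro restrict_in_stochastic_maps) auto
  moreover have "v x b = 0" if "x \<in> X" "b \<in> B" for x b
    using sum_nonneg_eq_0_iff[of B "v x"] that True assms by simp
  ultimately show ?thesis
    using True that by simp
next
  case False
  \<comment> \<open>The sign of \<open>w\<close> is only known when there is an input; for empty
    \<open>X\<close> the claims below are vacuous.\<close>
  have "0 \<le> w" if "x \<in> X" for x
    using sum[OF that] nonneg[OF that] by (auto intro: sum_nonneg)
  then have "(\<lambda>x\<in>X. \<lambda>b\<in>B. v x b / w) \<in> stochastic_maps X B"
    using assms False
    by (intro restrict_in_stochastic_maps) (auto simp: sum_divide_distrib[symmetric])
  then show ?thesis
    using False that by simp
qed

section \<open>Separable decomposition of an additive MAC\<close>

lemma separable_if_additive:
  assumes N: "N \<ge> 1" and A: "\<And>i. i \<in> {1..N} \<Longrightarrow> finite (A i) \<and> A i \<noteq> {}"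
    and B: "finite B" "B \<noteq> {}" and p: "p \<in> MACs N A B" and c: "c \<in> inputs N A"
    and additive: "\<And>a b. a \<in> inputs N A \<Longrightarrow> b \<in> B \<Longrightarrow>
      p a b = p c b + (\<Sum>i=1..N. p (c(i := a i)) b - p c b)"
  shows "p \<in> separable_MACs N A B"
proof -
  note p_nonneg = stochastic_maps_nonneg[OF p[unfolded MACs_def]]
  note p_sum = stochastic_maps_sum[OF p[unfolded MACs_def]]
  define h where "h i x b = p (c(i := x)) b - p c b" for i x b
  define m where "m i b = Min ((\<lambda>x. h i x b) ` A i)" for i b
  define e where "e b = p c b + (\<Sum>i=1..N. m i b)" for b
  define v where "v i x b = h i x b - m i b + (if i = 1 then e b else 0)" for i x b
  \<comment> \<open>This is the mass of \<open>v i x\<close> over \<open>B\<close> without the term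
    \<open>h i x b\<close>, whose sum over \<open>b\<close> is 0; hence it is independent of
    \<open>x\<close>.\<close>
  define w where "w i = (\<Sum>b\<in>B. (if i = 1 then e b else 0) - m i b)" for i
  have m_le: "m i b \<le> h i x b" if "i \<in> {1..N}" "x \<in> A i" for i x b
    unfolding m_def using A[OF that(1)] that(2) by (intro Min_le) auto
  have e_nonneg: "0 \<le> e b" if b: "b \<in> B" for b
  proof -
    have "\<exists>x\<in>A i. h i x b = m i b" if "i \<in> {1..N}" for i
      using Min_in[of "(\<lambda>x. h i x b) ` A i"] A[OF that] by (fastforce simp: m_def)
    \<comment> \<open>The minimizers may depend on \<open>b\<close>, which is fixed here;
      nonnegativity of \<open>e\<close> is needed only for one output at a time.\<close>
    then obtain s where s: "\<And>i. i \<in> {1..N} \<Longrightarrow> s i \<in> A i \<and> h i (s i) b = m i b"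
      by metis
    then have s_in: "restrict s {1..N} \<in> inputs N A"
      by (auto simp: inputs_def)
    have "p (restrict s {1..N}) b = e b"
      using s unfolding additive[OF s_in b] e_def h_def
      by (auto intro!: arg_cong2[where f = "(+)"] sum.cong)
    then show ?thesis
      using p_nonneg[OF s_in b] by simp
  qed
  have v_nonneg: "0 \<le> v i x b" if "i \<in> {1..N}" "x \<in> A i" "b \<in> B" for i x b
    using m_le[of i x b] e_nonneg[of b] that by (auto simp: v_def)
  have v_sum: "(\<Sum>b\<in>B. v i x b) = w i" if "i \<in> {1..N}" "x \<in> A i" for i x
  proof -
    have "c(i := x) \<in> inputs N A"
      using c that by (auto simp: inputs_def PiE_iff extensional_def)
    then have "(\<Sum>b\<in>B. h i x b) = 0"
      by (simp add: h_def sum_subtractf p_sum c)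
    then show ?thesis
      by (simp add: v_def w_def sum.distrib sum_subtractf)
  qed
  have "\<exists>g. g \<in> stochastic_maps (A i) B \<and> (\<forall>x\<in>A i. \<forall>b\<in>B. v i x b = w i * g x b)"
    if i: "i \<in> {1..N}" for i
  proof (rule normalize_nonneg_kernel[OF B])
    show "0 \<le> v i x b" if "x \<in> A i" "b \<in> B" for x b
      using v_nonneg[OF i that] .
    show "(\<Sum>b\<in>B. v i x b) = w i" if "x \<in> A i" for x
      using v_sum[OF i that] .
  qed blast
  then obtain g where g: "\<And>i. i \<in> {1..N} \<Longrightarrow> g i \<in> stochastic_maps (A i) B"
    and vg: "\<And>i x b. i \<in> {1..N} \<Longrightarrow> x \<in> A i \<Longrightarrow> b \<in> B \<Longrightarrow> v i x b = w i * g i x b"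
    by metis
  have w_nonneg: "0 \<le> w i" if i: "i \<in> {1..N}" for i
  proof -
    obtain x where "x \<in> A i"
      using A[OF i] by blast
    then show ?thesis
      using v_sum[OF i, of x] v_nonneg[OF i] sum_nonneg[of B "v i x"] by simp
  qed
  have p_eq: "p a b = (\<Sum>i=1..N. v i (a i) b)" if "a \<in> inputs N A" "b \<in> B" for a b
  proof -
    have "(\<Sum>i=1..N. if i = 1 then e b else 0) = e b"
      using N by (simp add: sum.delta')
    then have "(\<Sum>i=1..N. v i (a i) b) = (\<Sum>i=1..N. h i (a i) b) - (\<Sum>i=1..N. m i b) + e b"
      by (simp only: v_def sum.distrib sum_subtractf)
    then show ?thesis
      using additive[OF that] by (simp add: e_def h_def)
  qed
  have c_in: "c i \<in> A i" if "i \<in> {1..N}" for i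
    using c that by (auto simp: inputs_def)
  \<comment> \<open>As the masses do not depend on the inputs, they can be evaluated at
    \<open>c\<close>; swapping the sums gives the total mass of \<open>p c\<close>.\<close>
  have "(\<Sum>i=1..N. w i) = (\<Sum>i=1..N. \<Sum>b\<in>B. v i (c i) b)"
    using c_in by (intro sum.cong) (auto simp: v_sum)
  also have "\<dots> = (\<Sum>b\<in>B. \<Sum>i=1..N. v i (c i) b)"
    by (rule sum.swap)
  also have "\<dots> = 1"
    using p_eq[OF c] p_sum[OF c] by simp
  finally have w_sum: "(\<Sum>i=1..N. w i) = 1" .
  have "p a b = (\<Sum>i=1..N. w i * g i (a i) b)" if "a \<in> inputs N A" "b \<in> B" for a b
  proof -
    have "a i \<in> A i" if "i \<in> {1..N}" for i
      using \<open>a \<in> inputs N A\<close> that by (auto simp: inputs_def)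
    then show ?thesis
      unfolding p_eq[OF that] using that by (intro sum.cong) (auto simp: vg)
  qed
  then show ?thesis
    unfolding separable_MACs_def using p w_nonneg w_sum g by blast
qed

section \<open>Separability versus vanishing interference\<close>

theorem theorem1:
  fixes N :: nat and A :: "nat \<Rightarrow> 'a set" and B :: "'b set"
  assumes "N \<ge> 1"
    and "\<And>i. i \<in> {1..N} \<Longrightarrow> finite (A i) \<and> A i \<noteq> {}"
    and "finite B" and "B \<noteq> {}"
  shows "separable_MACs N A B = interference_free_MACs N A B"
proof -
  have A: "\<forall>i\<in>{1..N}. finite (A i) \<and> A i \<noteq> {}"
    using assms(2) by blast
  show ?thesis
  proof (intro equalityI subsetI)
    fix p assume "p \<in> separable_MACs N A B"
    then obtain w g where p: "p \<in> MACs N A B"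
      and eq: "\<And>a b. a \<in> inputs N A \<Longrightarrow> b \<in> B \<Longrightarrow> p a b = (\<Sum>i=1..N. w i * g i (a i) b)"
      unfolding separable_MACs_def by blast
    have "interference2 N A B i j p = 0" if ij: "i \<in> {1..N}" "j \<in> {1..N}" "i \<noteq> j" for i j
      unfolding interference2_eq_0_iff[OF A assms(3,4) ij(1,2)]
    proof (intro ballI)
      fix c b x x' y y'
      assume *: "c \<in> inputs N A" "b \<in> B" "x \<in> A i" "x' \<in> A i" "y \<in> A j" "y' \<in> A j"
      have "c(i := s, j := t) \<in> inputs N A" if "s \<in> A i" "t \<in> A j" for s t
        using * ij that by (auto simp: inputs_def PiE_iff extensional_def)
      then show "p (c(i := x, j := y)) b + p (c(i := x', j := y')) b
         - p (c(i := x, j := y')) b - p (c(i := x', j := y)) b = 0"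
        \<comment> \<open>Each summand of a separable MAC depends on a single coordinate, so its
          mixed differences cancel.\<close>
        using * by (simp only: eq sum_second_difference_eq_0[OF ij(3), of "\<lambda>k z. w k * g k z b"])
    qed
    then show "p \<in> interference_free_MACs N A B"
      using p by (simp add: interference_free_MACs_def)
  next
    fix p assume "p \<in> interference_free_MACs N A B"
    then have p: "p \<in> MACs N A B" and free:
      "\<And>i j. i \<in> {1..N} \<Longrightarrow> j \<in> {1..N} \<Longrightarrow> i \<noteq> j \<Longrightarrow> interference2 N A B i j p = 0"
      by (auto simp: interference_free_MACs_def)
    have I: "p (c(i := x, j := y)) b + p (c(i := x', j := y')) b
         - p (c(i := x, j := y')) b - p (c(i := x', j := y)) b = 0"
      if "i \<in> {1..N}" "j \<in> {1..N}" "i \<noteq> j" "c \<in> inputs N A" "b \<in> B"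
        "x \<in> A i" "x' \<in> A i" "y \<in> A j" "y' \<in> A j" for i j c b x x' y y'
      using free[OF that(1-3)] that(4-)
      unfolding interference2_eq_0_iff[OF A assms(3,4) that(1,2)] by blast
    have diff: "p (c(i := x, j := y)) b - p (c(i := x)) b = p (c(j := y)) b - p c b"
      if "b \<in> B" "c \<in> Pi\<^sub>E {1..N} A" "i \<in> {1..N}" "j \<in> {1..N}" "i \<noteq> j" "x \<in> A i" "y \<in> A j"
      for b c i j x y
    proof -
      \<comment> \<open>Choosing the current entries \<open>c i\<close> and \<open>c j\<close> as
        the second pair of inputs in \<open>I\<close> makes their updates trivial.\<close>
      have "c(i := x, j := c j) = c(i := x)" "c(i := c i, j := y) = c(j := y)"
        "c(i := c i, j := c j) = c" "c i \<in> A i" "c j \<in> A j"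
        using that by (auto simp: fun_eq_iff)
      then show ?thesis
        using I[of i j c b x "c i" y "c j"] that unfolding inputs_def by simp
    qed
    \<comment> \<open>A base point exists because every input set is nonempty.\<close>
    obtain c where c: "c \<in> inputs N A"
      using A PiE_eq_empty_iff[of "{1..N}" A] unfolding inputs_def by blast
    have "p a b = p c b + (\<Sum>i=1..N. p (c(i := a i)) b - p c b)"
      if "a \<in> inputs N A" "b \<in> B" for a b
      using that(1) c diff[OF that(2)] unfolding inputs_def
      by (intro additive_if_second_differences_eq_0'[where F = "\<lambda>a. p a b" and A = A]
          finite_atLeastAtMost) assumption+
    with assms(2) show "p \<in> separable_MACs N A B"
      by (rule separable_if_additive[OF assms(1) _ assms(3,4) p c])
  qed
qed

end
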